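(* For any $q\in P$ of degree $d$, $\langle q\rangle_n=\langle q\rangle_d$ for all $n\ge d$. In particular, if $\{V_n\}_{n\ge1}$ and $\{W_n\}_{n\ge1}$ are families of representations ($V_n$, $W_n$ being representations of $S_n$) with polynomial characters of degree $d_1$ and $d_2$ respectively, then $\langle V_n,W_n\rangle_n$ stabilizes (is constant in $n$) for $n\ge d_1+d_2$.
   Context: Let $K$ be a field of characteristic $0$ and $P=K[X_1,X_2,\dots]$, graded so that $X_i$ has degree $i$; degrees of elements of $P$ refer to this grading. For $w\in S_n$ let $X_i(w)$ be the number of $i$-cycles of $w$. For $q\in P$, the moment of $q$ at $n$ is $\langle q\rangle_n=\frac1{n!}\sum_{w\in S_n}q(X_1(w),X_2(w),\dots)$. All representations are finite-dimensional over $K$. A family $\{V_n\}_{n\ge 1}$, with $V_n$ a representation of $S_n$, has polynomial character with character polynomial $q\in P$ if $\mathrm{trace}(w;V_n)=q(X_1(w),X_2(w),\dots)$ for all $n\ge1$ and all $w\in S_n$; the degree of the polynomial character is the degree of $q$. For representations $V,W$ of $S_n$, $\langle V,W\rangle_n=\dim\mathrm{Hom}_{S_n}(V,W)$. *)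

theory Defs
  imports
    Complex_Main
    "HOL-Algebra.Sym_Groups"
    "HOL-Algebra.Group_Action"
    "HOL-Combinatorics.Orbits"
    "HOL-Library.Function_Algebras"
    "HOL-Library.Poly_Mapping"
begin

text \<open>
  Polynomials in variables indexed by \<open>nat\<close>: a monomial is its finitely supported exponent
  function, a polynomial is a finitely supported map from monomials to coefficients.
  The ring \<open>K[X\<^sub>1, X\<^sub>2, \<dots>]\<close> is the subset in which the variable of index 0 does not occur.
\<close>

type_synonym 'k poly_vars = "(nat \<Rightarrow>\<^sub>0 nat) \<Rightarrow>\<^sub>0 'k"

definition poly_ring :: "'k::comm_ring_1 poly_vars set" where
  "poly_ring = {q. \<forall>m \<in> Poly_Mapping.keys q. 0 \<notin> Poly_Mapping.keys m}"

definition poly_eval :: "(nat \<Rightarrow> 'k) \<Rightarrow> 'k::comm_ring_1 poly_vars \<Rightarrow> 'k" where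
  "poly_eval x q = (\<Sum>m \<in> Poly_Mapping.keys q. Poly_Mapping.lookup q m * (\<Prod>i \<in> Poly_Mapping.keys m. x i ^ Poly_Mapping.lookup m i))"

definition monom_degree :: "(nat \<Rightarrow>\<^sub>0 nat) \<Rightarrow> nat" where
  "monom_degree m = (\<Sum>i \<in> Poly_Mapping.keys m. i * Poly_Mapping.lookup m i)"

text \<open>The variable of index \<open>i\<close> has degree \<open>i\<close>; the zero polynomial gets degree 0.\<close>

definition graded_degree :: "'k::comm_ring_1 poly_vars \<Rightarrow> nat" where
  "graded_degree q = Max (insert 0 (monom_degree ` Poly_Mapping.keys q))"

text \<open>
  The cycles of \<open>w\<close> are taken inside \<open>{1..n}\<close>: as a function on \<open>nat\<close>, \<open>w\<close> also fixes
  every number outside this set.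
\<close>

definition cycle_count :: "nat \<Rightarrow> (nat \<Rightarrow> nat) \<Rightarrow> nat \<Rightarrow> nat" where
  "cycle_count n w i = card {C. C \<subseteq> {1..n} \<and> cyclic_on w C \<and> card C = i}"

definition eval_cycles :: "nat \<Rightarrow> 'k::comm_ring_1 poly_vars \<Rightarrow> (nat \<Rightarrow> nat) \<Rightarrow> 'k" where
  "eval_cycles n q w = poly_eval (\<lambda>i. of_nat (cycle_count n w i)) q"

definition moment :: "'k::field_char_0 poly_vars \<Rightarrow> nat \<Rightarrow> 'k" where
  "moment q n = (\<Sum>w \<in> carrier (sym_group n). eval_cycles n q w) / fact n"

text \<open>
  A finite-dimensional representation lives on a finite-dimensional subspace \<open>V\<close> of an ambient
  vector space, so that the members of a family can be spaces of different dimension over one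
  type. As in \<^locale>\<open>group_action\<close>, the maps \<open>\<rho> w\<close> are undefined outside \<open>V\<close>.
\<close>

definition linear_within ::
  "('k \<Rightarrow> 'v \<Rightarrow> 'v) \<Rightarrow> ('k \<Rightarrow> 'w \<Rightarrow> 'w) \<Rightarrow> 'v::ab_group_add set \<Rightarrow> ('v \<Rightarrow> 'w::ab_group_add) \<Rightarrow> bool"
  where
  "linear_within s t V f \<longleftrightarrow>
     (\<forall>x\<in>V. \<forall>y\<in>V. f (x + y) = f x + f y) \<and> (\<forall>c. \<forall>x\<in>V. f (s c x) = t c (f x))"

context vector_space
begin

definition sym_rep :: "nat \<Rightarrow> 'b set \<Rightarrow> ((nat \<Rightarrow> nat) \<Rightarrow> 'b \<Rightarrow> 'b) \<Rightarrow> bool" where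
  "sym_rep n V \<rho> \<longleftrightarrow>
     subspace V \<and> (\<exists>B. finite B \<and> span B = V) \<and>
     group_action (sym_group n) V \<rho> \<and>
     (\<forall>w \<in> carrier (sym_group n). linear_within scale scale V (\<rho> w))"

definition trace_on :: "'b set \<Rightarrow> ('b \<Rightarrow> 'b) \<Rightarrow> 'a" where
  "trace_on V f =
     (let B = (SOME B. independent B \<and> span B = V) in \<Sum>b\<in>B. representation B (f b) b)"

end

definition has_character_polynomial ::
  "('k::field_char_0 \<Rightarrow> 'v::ab_group_add \<Rightarrow> 'v) \<Rightarrow> (nat \<Rightarrow> 'v set) \<Rightarrow>
   (nat \<Rightarrow> (nat \<Rightarrow> nat) \<Rightarrow> 'v \<Rightarrow> 'v) \<Rightarrow> 'k poly_vars \<Rightarrow> bool"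
  where
  "has_character_polynomial s V \<rho> q \<longleftrightarrow>
     q \<in> poly_ring \<and>
     (\<forall>n\<ge>1. \<forall>w \<in> carrier (sym_group n).
        vector_space.trace_on s (V n) (\<rho> n w) = eval_cycles n q w)"

text \<open>
  Homomorphisms are made total by the value 0 outside \<open>V\<close>, so that they form a subspace of the
  pointwise vector space of all functions.
\<close>

definition sym_hom ::
  "nat \<Rightarrow> ('k \<Rightarrow> 'v \<Rightarrow> 'v) \<Rightarrow> 'v::ab_group_add set \<Rightarrow> ((nat \<Rightarrow> nat) \<Rightarrow> 'v \<Rightarrow> 'v) \<Rightarrow>
   ('k \<Rightarrow> 'w \<Rightarrow> 'w) \<Rightarrow> 'w::ab_group_add set \<Rightarrow> ((nat \<Rightarrow> nat) \<Rightarrow> 'w \<Rightarrow> 'w) \<Rightarrow> ('v \<Rightarrow> 'w) set"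
  where
  "sym_hom n s V \<rho> t W \<sigma> =
     {f. f ` V \<subseteq> W \<and> (\<forall>x. x \<notin> V \<longrightarrow> f x = 0) \<and> linear_within s t V f \<and>
         (\<forall>w \<in> carrier (sym_group n). \<forall>x\<in>V. f (\<rho> w x) = \<sigma> w (f x))}"

lemma vector_space_pointwise:
  assumes "vector_space (t :: 'k::field \<Rightarrow> 'w::ab_group_add \<Rightarrow> 'w)"
  shows "vector_space (\<lambda>c (f :: 'v \<Rightarrow> 'w) x. t c (f x))"
proof -
  interpret vector_space t by fact
  show ?thesis
    by unfold_locales (simp_all add: fun_eq_iff scale_right_distrib scale_left_distrib)
qed

definition hom_dim ::
  "nat \<Rightarrow> ('k::field \<Rightarrow> 'v \<Rightarrow> 'v) \<Rightarrow> 'v::ab_group_add set \<Rightarrow> ((nat \<Rightarrow> nat) \<Rightarrow> 'v \<Rightarrow> 'v) \<Rightarrow>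
   ('k \<Rightarrow> 'w \<Rightarrow> 'w) \<Rightarrow> 'w::ab_group_add set \<Rightarrow> ((nat \<Rightarrow> nat) \<Rightarrow> 'w \<Rightarrow> 'w) \<Rightarrow> nat"
  where
  "hom_dim n s V \<rho> t W \<sigma> =
     vector_space.dim (\<lambda>c (f :: 'v \<Rightarrow> 'w) x. t c (f x)) (sym_hom n s V \<rho> t W \<sigma>)"

end

theory Submission
  imports Defs
begin

text \<open>
  Both halves rest on one recursion. Choosing an \<open>i\<close>-cycle of a permutation of \<open>n\<close> points and
  deleting it leaves a permutation of \<open>n - i\<close> points with one \<open>i\<close>-cycle less. So for every function
  \<open>F\<close> of the cycle counts and all \<open>n \<ge> i\<close>, the mean of \<open>X\<^sub>i F\<close> over the permutations of \<open>n\<close> points is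
  \<open>k\<^sub>i\<close> times the mean of \<open>\<tau>\<^sub>i F\<close> over those of \<open>n - i\<close> points, where \<open>\<tau>\<^sub>i\<close> is the substitution
  \<open>X\<^sub>i \<mapsto> X\<^sub>i + 1\<close> and \<open>k\<^sub>i\<close>, the proportion of full cycles among the permutations of \<open>i\<close> points, is
  independent of \<open>n\<close>. The recursion trades the factor \<open>X\<^sub>i\<close>, of degree \<open>i\<close>, for \<open>i\<close> of the \<open>n\<close> points,
  hence each such factor raises the threshold from which the mean is constant by at most \<open>i\<close>
  (\<open>cycle_mean_times_variable\<close>). To let an induction run, monomials are replaced by products of
  factors \<open>X\<^sub>i + c\<close>: the substitution \<open>\<tau>\<^sub>i\<close> only alters the constants \<open>c\<close> in such a product, so
  the number of factors decreases at every step (\<open>stable_from_linear_product\<close>).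
  Linear combinations give polynomials, and products of two polynomials.

  For representations, the dimension of \<open>Hom\<close> over the symmetric group is the trace of the averaging
  projection on the space of all linear maps \<open>V \<rightarrow> W\<close> (\<open>trace_projection\<close>). In the basis of
  matrix units this trace is \<open>1/n! \<Sum>\<^sub>w trace(w\<inverse>; V) trace(w; W)\<close>. A permutation and its inverse
  have the same cycles, so for character polynomials \<open>q\<^sub>1\<close> and \<open>q\<^sub>2\<close> the dimension is the moment of the
  product \<open>q\<^sub>1 q\<^sub>2\<close>, whose degree is at most \<open>d\<^sub>1 + d\<^sub>2\<close>. Since \<open>K\<close> has characteristic \<open>0\<close>, equality of
  dimensions in \<open>K\<close> is equality of natural numbers.
\<close>

section \<open>Deleting a cycle from a permutation\<close>

text \<open>
  Unlike \<^const>\<open>cycle_count\<close>, this is relative to an arbitrary set of points. Deleting a cycle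
  from a permutation of an interval leaves a permutation of a set that need not be an interval.
\<close>

definition cycle_type :: "'a set \<Rightarrow> ('a \<Rightarrow> 'a) \<Rightarrow> nat \<Rightarrow> nat" where
  "cycle_type A w i = card {C. C \<subseteq> A \<and> cyclic_on w C \<and> card C = i}"

lemma cycle_count_eq_cycle_type: "cycle_count n = cycle_type {1..n}"
  by (simp add: fun_eq_iff cycle_count_def cycle_type_def)

lemma cycle_type_transport:
  assumes f: "bij_betw f A B" and comm: "\<And>x. x \<in> A \<Longrightarrow> w' (f x) = f (w x)"
    and w: "w ` A \<subseteq> A"
  shows "cycle_type B w' = cycle_type A w"
proof
  fix i
  define g where "g = inv_into A f"
  have gf: "g (f x) = x" if "x \<in> A" for x
    using f that by (simp add: g_def bij_betw_inv_into_left)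
  have fg: "f (g y) = y" and gA: "g y \<in> A" if "y \<in> B" for y
    using f that by (auto simp: g_def bij_betw_inv_into_right bij_betw_def inv_into_into)
  have fB: "f ` A = B" using f by (simp add: bij_betw_def)
  have fC: "g ` f ` C = C" if "C \<subseteq> A" for C
    unfolding image_image using that gf by (metis (no_types, lifting) image_cong image_ident subsetD)
  have gC: "f ` g ` C = C" if "C \<subseteq> B" for C
    unfolding image_image using that fg by (metis (no_types, lifting) image_cong image_ident subsetD)
  have comm': "w (g y) = g (w' y)" if "y \<in> B" for y
    using comm[OF gA[OF that]] gf[of "w (g y)"] gA[OF that] w fg[OF that] by (metis image_subset_iff)
  have "bij_betw ((`) f) {C. C \<subseteq> A \<and> cyclic_on w C \<and> card C = i}
      {C. C \<subseteq> B \<and> cyclic_on w' C \<and> card C = i}"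
  proof (rule bij_betw_byWitness[where f' = "(`) g"])
    show "(`) f ` {C. C \<subseteq> A \<and> cyclic_on w C \<and> card C = i}
        \<subseteq> {C. C \<subseteq> B \<and> cyclic_on w' C \<and> card C = i}"
    proof safe
      fix C x assume C: "C \<subseteq> A" "cyclic_on w C"
      show "cyclic_on w' (f ` C)" using C comm by (intro cyclic_on_image[of w]) auto
      show "card (f ` C) = card C"
        using C f by (intro card_image) (auto simp: bij_betw_def inj_on_subset)
      show "f x \<in> B" if "x \<in> C" using C fB that by auto
    qed
    show "(`) g ` {C. C \<subseteq> B \<and> cyclic_on w' C \<and> card C = i}
        \<subseteq> {C. C \<subseteq> A \<and> cyclic_on w C \<and> card C = i}"
    proof safe
      fix C x assume C: "C \<subseteq> B" "cyclic_on w' C"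
      show "cyclic_on w (g ` C)" using C comm' by (intro cyclic_on_image[of w']) auto
      show "card (g ` C) = card C"
        using C fg by (intro card_image) (metis inj_on_def subset_iff)
      show "g x \<in> A" if "x \<in> C" using C gA that by auto
    qed
  qed (simp_all add: fC gC)
  then show "cycle_type B w' i = cycle_type A w i"
    unfolding cycle_type_def by (rule bij_betw_same_card[symmetric])
qed

text \<open>
  Conjugating by a bijection between the two sets matches up their permutations and preserves
  cycle types.
\<close>

lemma sum_permutations_cong_card:
  fixes F :: "(nat \<Rightarrow> nat) \<Rightarrow> 'k::comm_monoid_add"
  assumes "finite A" "finite B" "card A = card B"
  shows "(\<Sum>w | w permutes A. F (cycle_type A w)) = (\<Sum>w | w permutes B. F (cycle_type B w))"
proof -
  obtain f where f: "bij_betw f A B"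
    using assms finite_same_card_bij by blast
  define h where "h = (\<lambda>\<pi> x. if x \<in> B then f (\<pi> (inv_into A f x)) else x)"
  have "bij_betw h {\<pi>. \<pi> permutes A} {\<pi>. \<pi> permutes B}"
    unfolding h_def by (rule bij_betw_permutations[OF f])
  moreover have "cycle_type B (h w) = cycle_type A w" if "w permutes A" for w
    by (rule cycle_type_transport[OF f])
      (use f that in \<open>auto simp: h_def bij_betw_inv_into_left bij_betwE permutes_in_image\<close>)
  ultimately show ?thesis
    by (intro sum.reindex_bij_betw[where h = h, symmetric, THEN trans, symmetric]) auto
qed

lemma cyclic_on_disjoint:
  assumes "cyclic_on w C" "cyclic_on w D"
  shows "C = D \<or> C \<inter> D = {}"
  using assms by (metis disjoint_iff orbit_cyclic_eq3)

abbreviation incr :: "nat \<Rightarrow> (nat \<Rightarrow> nat) \<Rightarrow> nat \<Rightarrow> nat" where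
  "incr i x \<equiv> x(i := Suc (x i))"

text \<open>
  Distinct cycles are disjoint, so every cycle of \<open>w\<close> other than \<open>C\<close> lies in \<open>A - C\<close>, where \<open>w\<close>
  agrees with \<open>v\<close>.
\<close>

lemma cycle_type_remove_cycle:
  assumes "finite A" "C \<subseteq> A" "cyclic_on w C" "v permutes A - C" "\<And>x. x \<in> A - C \<Longrightarrow> w x = v x"
  shows "cycle_type A w = incr (card C) (cycle_type (A - C) v)"
proof
  fix i
  let ?S = "{D. D \<subseteq> A - C \<and> cyclic_on v D \<and> card D = i}"
  have cong: "cyclic_on w D \<longleftrightarrow> cyclic_on v D" if "D \<subseteq> A - C" for D
    using that assms(5) by (intro cyclic_cong) auto
  have "{D. D \<subseteq> A \<and> cyclic_on w D \<and> card D = i} = ?S \<union> (if i = card C then {C} else {})"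
    (is "?T = _")
  proof (rule Set.set_eqI)
    fix D
    have "D \<subseteq> A - C \<or> D = C" if "D \<subseteq> A" "cyclic_on w D"
      using cyclic_on_disjoint[OF assms(3) that(2)] that(1) by blast
    then show "D \<in> ?T
        \<longleftrightarrow> D \<in> ?S \<union> (if i = card C then {C} else {})"
      using cong[of D] assms(2,3) by auto
  qed
  moreover have "C \<notin> ?S"
    using assms(3) by (auto simp: cyclic_on_alldef)
  moreover have "finite ?S"
    using assms(1) by (auto intro: finite_subset[of _ "Pow A"])
  ultimately show "cycle_type A w i = incr (card C) (cycle_type (A - C) v) i"
    by (cases "i = card C") (simp_all add: cycle_type_def del: mem_Collect_eq)
qed

lemma perm_restrict_cyclic_permutes:
  assumes "w permutes A" "cyclic_on w C"
  shows "perm_restrict w C permutes C"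
proof (rule bij_imp_permutes)
  have "w ` C = C"
    using assms by (intro endo_inj_surj)
      (auto simp: finite_cyclic_on permutes_inj_on intro: cyclic_on_inI)
  then have "bij_betw w C C" using assms(1) by (simp add: bij_betw_def permutes_inj_on)
  then show "bij_betw (perm_restrict w C) C C"
    by (rule bij_betw_cong[THEN iffD1, rotated]) (simp add: perm_restrict_simps)
qed (simp add: perm_restrict_simps)

text \<open>
  A permutation of \<open>A\<close> for which \<open>C\<close> is a cycle is the same as a cyclic permutation of \<open>C\<close> together
  with an arbitrary permutation of \<open>A - C\<close>.
\<close>

lemma sum_permutations_with_cycle:
  fixes F :: "(nat \<Rightarrow> nat) \<Rightarrow> 'k::comm_semiring_1"
  assumes A: "finite A" "C \<subseteq> A"
  shows "(\<Sum>w | w permutes A \<and> cyclic_on w C. F (cycle_type A w))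
    = of_nat (card {u. u permutes C \<and> cyclic_on u C})
      * (\<Sum>v | v permutes A - C. F (incr (card C) (cycle_type (A - C) v)))"
    (is "?L = of_nat (card ?U) * sum ?f ?V")
proof -
  have "?L = (\<Sum>(u, v) \<in> ?U \<times> ?V. ?f v)"
  proof (rule sum.reindex_bij_witness[where i = "\<lambda>(u, v). u \<circ> v"
        and j = "\<lambda>w. (perm_restrict w C, perm_restrict w (A - C))"])
    fix w assume "w \<in> {w. w permutes A \<and> cyclic_on w C}"
    then have w: "w permutes A" "cyclic_on w C" by auto
    note rC = perm_restrict_cyclic_permutes[OF w] and rD = perm_restrict_diff_cyclic[OF w]
    show "(perm_restrict w C, perm_restrict w (A - C)) \<in> ?U \<times> ?V"
      using rC rD w by (simp add: cyclic_on_perm_restrict)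
    have "C \<union> (A - C) = A" using A by blast
    then show "(case (perm_restrict w C, perm_restrict w (A - C)) of (u, v) \<Rightarrow> u \<circ> v) = w"
      using perm_restrict_union[OF rC rD] w by simp
    show "(case (perm_restrict w C, perm_restrict w (A - C)) of (u, v) \<Rightarrow> ?f v)
        = F (cycle_type A w)"
      using cycle_type_remove_cycle[OF A w(2) rD] by (simp add: perm_restrict_simps)
  next
    fix p assume "p \<in> ?U \<times> ?V"
    then obtain u v where p: "p = (u, v)" and u: "u permutes C" "cyclic_on u C"
      and v: "v permutes A - C" by auto
    have uv: "(u \<circ> v) x = (if x \<in> C then u x else v x)" for x
    proof (cases "x \<in> C")
      case True
      then show ?thesis using permutes_not_in[OF v, of x] by simp
    next
      case False
      then have "v x \<notin> C"
        using permutes_in_image[OF v, of x] permutes_not_in[OF v, of x] by fastforce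
      then show ?thesis using False permutes_not_in[OF u(1)] by simp
    qed
    have "u permutes A" "v permutes A"
      using u v A by (auto intro: permutes_subset)
    then have "u \<circ> v permutes A" by (rule permutes_compose[rotated])
    moreover have "cyclic_on (u \<circ> v) C"
      using u(2) uv cyclic_cong[of C "u \<circ> v" u] by simp
    ultimately show "(case p of (u, v) \<Rightarrow> u \<circ> v) \<in> {w. w permutes A \<and> cyclic_on w C}"
      using p by simp
    have "perm_restrict (u \<circ> v) C = u" "perm_restrict (u \<circ> v) (A - C) = v"
      using permutes_not_in[OF u(1)] permutes_not_in[OF v] A
      unfolding perm_restrict_def fun_eq_iff uv by auto
    then show "(perm_restrict (case p of (u, v) \<Rightarrow> u \<circ> v) C,
        perm_restrict (case p of (u, v) \<Rightarrow> u \<circ> v) (A - C)) = p"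
      using p by simp
  qed
  also have "\<dots> = (\<Sum>u\<in>?U. \<Sum>v\<in>?V. ?f v)"
    by (rule sum.cartesian_product[symmetric])
  finally show ?thesis by simp
qed

definition full_cycles :: "nat \<Rightarrow> nat" where
  "full_cycles i = card {u. u permutes {1..i} \<and> cyclic_on u {1..i}}"

text \<open>
  Being a full cycle on \<open>C\<close> can be read off from the cycle type, so the count is a sum over
  permutations of a function of the cycle type and depends on the cardinality of \<open>C\<close> alone.
\<close>

lemma card_full_cycles:
  assumes "finite C"
  shows "card {u. u permutes C \<and> cyclic_on u C} = full_cycles (card C)"
proof -
  have *: "card {u. u permutes C \<and> cyclic_on u C}
      = (\<Sum>u | u permutes C. of_bool (cycle_type C u (card C) \<noteq> 0))"
    if C: "finite C" for C :: "'b set"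
  proof -
    have "{D. D \<subseteq> C \<and> cyclic_on u D \<and> card D = card C} = (if cyclic_on u C then {C} else {})"
      for u :: "'b \<Rightarrow> 'b"
      using C by (auto dest: card_subset_eq)
    then have "cycle_type C u (card C) = of_bool (cyclic_on u C)" for u
      by (simp add: cycle_type_def)
    then show ?thesis
      using C by (simp add: of_bool_def sum.If_cases finite_permutations Collect_conj_eq)
  qed
  have "(\<Sum>u | u permutes C. of_bool (cycle_type C u (card C) \<noteq> 0))
    = (\<Sum>u | u permutes {1..card C}. of_bool (cycle_type {1..card C} u (card C) \<noteq> 0) :: nat)"
    using assms by (intro sum_permutations_cong_card) auto
  then show ?thesis
    using *[OF assms] *[of "{1..card C}"] by (simp add: full_cycles_def)
qed

text \<open>
  Double counting of the pairs of a permutation \<open>w\<close> and an \<open>i\<close>-cycle \<open>C\<close> of \<open>w\<close>: the factor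
  \<open>X\<^sub>i(w)\<close> counts the \<open>C\<close> for given \<open>w\<close>, while for each of the \<open>n choose i\<close> sets \<open>C\<close> the permutations
  \<open>w\<close> are described by \<open>sum_permutations_with_cycle\<close>.
\<close>

lemma sum_permutations_times_cycle_count:
  fixes F :: "(nat \<Rightarrow> nat) \<Rightarrow> 'k::comm_semiring_1"
  shows "(\<Sum>w | w permutes {1..n}. of_nat (cycle_count n w i) * F (cycle_count n w))
    = of_nat ((n choose i) * full_cycles i)
      * (\<Sum>v | v permutes {1..n - i}. F (incr i (cycle_count (n - i) v)))"
proof -
  let ?A = "{1..n}" and ?S = "\<Sum>v | v permutes {1..n - i}. F (incr i (cycle_count (n - i) v))"
  have "(\<Sum>w | w permutes ?A. of_nat (cycle_count n w i) * F (cycle_count n w))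
      = (\<Sum>w | w permutes ?A. \<Sum>C | C \<subseteq> ?A \<and> card C = i \<and> cyclic_on w C. F (cycle_type ?A w))"
    by (simp add: cycle_count_eq_cycle_type) (simp add: cycle_type_def conj_ac)
  also have "\<dots> = (\<Sum>w | w permutes ?A. \<Sum>C | C \<subseteq> ?A \<and> card C = i.
      if cyclic_on w C then F (cycle_type ?A w) else 0)"
    by (intro sum.cong refl sum.mono_neutral_cong_left)
       (auto intro: finite_subset[of _ "Pow ?A"])
  also have "\<dots> = (\<Sum>C | C \<subseteq> ?A \<and> card C = i. \<Sum>w | w permutes ?A.
      if cyclic_on w C then F (cycle_type ?A w) else 0)"
    by (rule sum.swap)
  also have "\<dots> = (\<Sum>C | C \<subseteq> ?A \<and> card C = i. of_nat (full_cycles i) * ?S)"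
  proof (rule sum.cong)
    fix C assume "C \<in> {C. C \<subseteq> ?A \<and> card C = i}"
    then have C: "C \<subseteq> ?A" "card C = i" "finite C" by (auto intro: finite_subset)
    have "(\<Sum>w | w permutes ?A. if cyclic_on w C then F (cycle_type ?A w) else 0)
        = (\<Sum>w | w permutes ?A \<and> cyclic_on w C. F (cycle_type ?A w))"
      by (intro sum.mono_neutral_cong_right) (auto simp: finite_permutations)
    also have "\<dots> = of_nat (full_cycles i)
        * (\<Sum>v | v permutes ?A - C. F (incr i (cycle_type (?A - C) v)))"
      using sum_permutations_with_cycle[of ?A C F] C card_full_cycles[OF C(3)] by simp
    also have "(\<Sum>v | v permutes ?A - C. F (incr i (cycle_type (?A - C) v))) = ?S"
      unfolding cycle_count_eq_cycle_type
      using C by (intro sum_permutations_cong_card) (auto simp: card_Diff_subset)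
    finally show "(\<Sum>w | w permutes ?A. if cyclic_on w C then F (cycle_type ?A w) else 0)
        = of_nat (full_cycles i) * ?S" .
  qed simp
  also have "\<dots> = of_nat ((n choose i) * full_cycles i) * ?S"
    using n_subsets[of ?A i] by (simp add: mult.assoc)
  finally show ?thesis .
qed

section \<open>Means of functions of the cycle counts\<close>

definition cycle_mean :: "((nat \<Rightarrow> nat) \<Rightarrow> 'k::field_char_0) \<Rightarrow> nat \<Rightarrow> 'k" where
  "cycle_mean F n = (\<Sum>w | w permutes {1..n}. F (cycle_count n w)) / fact n"

text \<open>
  The recursion behind stability. Divided by \<open>n!\<close>, the binomial coefficient becomes
  \<open>1 / (i! (n - i)!)\<close>; the second factorial normalises the mean over \<open>n - i\<close> points, so that the
  coefficient in front of it no longer involves \<open>n\<close>.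
\<close>

lemma cycle_mean_times_variable:
  assumes "i \<le> n"
  shows "cycle_mean (\<lambda>x. of_nat (x i) * F x) n
    = of_nat (full_cycles i) / fact i * cycle_mean (\<lambda>x. F (incr i x)) (n - i)"
  unfolding cycle_mean_def sum_permutations_times_cycle_count
  using assms by (simp add: binomial_fact)

lemma cycle_mean_add: "cycle_mean (\<lambda>x. F x + G x) n = cycle_mean F n + cycle_mean G n"
  by (simp add: cycle_mean_def sum.distrib add_divide_distrib)

lemma cycle_mean_scale: "cycle_mean (\<lambda>x. c * F x) n = c * cycle_mean F n"
  by (simp add: cycle_mean_def sum_distrib_left)

lemma cycle_mean_sum: "cycle_mean (\<lambda>x. \<Sum>a\<in>S. F a x) n = (\<Sum>a\<in>S. cycle_mean (F a) n)"
  by (simp add: cycle_mean_def sum.swap[of _ S] sum_divide_distrib)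

lemma cycle_mean_const: "cycle_mean (\<lambda>x. 1) n = 1"
  by (simp add: cycle_mean_def card_permutations)

definition stable_from :: "nat \<Rightarrow> ((nat \<Rightarrow> nat) \<Rightarrow> 'k::field_char_0) \<Rightarrow> bool" where
  "stable_from d F \<longleftrightarrow> (\<forall>m\<ge>d. \<forall>n\<ge>d. cycle_mean F m = cycle_mean F n)"

lemma stable_from_linear_combination:
  assumes "\<And>a. a \<in> S \<Longrightarrow> stable_from d (F a)"
  shows "stable_from d (\<lambda>x. \<Sum>a\<in>S. c a * F a x)"
  unfolding stable_from_def cycle_mean_sum cycle_mean_scale
  by (intro allI impI sum.cong refl) (metis assms stable_from_def)

text \<open>
  The constants make this class of products closed under raising one cycle count by \<open>1\<close>,
  which the class of monomials is not.
\<close>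

definition linear_product :: "(nat \<times> 'k::field_char_0) list \<Rightarrow> (nat \<Rightarrow> nat) \<Rightarrow> 'k" where
  "linear_product l x = (\<Prod>(i, c)\<leftarrow>l. of_nat (x i) + c)"

lemma linear_product_incr:
  "linear_product l (incr i x) = linear_product (map (\<lambda>(j, c). (j, if j = i then c + 1 else c)) l) x"
proof (induction l)
  case (Cons a l)
  then show ?case
    by (cases a; cases "fst a = i") (simp_all add: linear_product_def add_ac)
qed (simp add: linear_product_def)

text \<open>
  A leading factor \<open>X\<^sub>i + c\<close> splits the mean into one of \<open>c\<close> times the remaining product, and one that the
  recursion expresses through a product with the same indices as the remaining one on \<open>n - i\<close>
  points. The induction is on the number of factors because the constants change.
\<close>

lemma stable_from_linear_product: "stable_from (sum_list (map fst l)) (linear_product l)"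
proof (induction "length l" arbitrary: l)
  case 0
  then show ?case by (simp add: stable_from_def linear_product_def cycle_mean_const)
next
  case (Suc k)
  then obtain i c l' where l: "l = (i, c) # l'" and k: "k = length l'" by (cases l) auto
  define l'' where "l'' = map (\<lambda>(j, c). (j, if j = i then c + 1 else c)) l'"
  define d where "d = sum_list (map fst l')"
  have "length l'' = k" "map fst l'' = map fst l'" by (auto simp: l''_def k)
  then have stable: "stable_from d (linear_product l')" "stable_from d (linear_product l'')"
    using Suc.hyps(1)[of l'] Suc.hyps(1)[of l''] k by (simp_all add: d_def)
  have mean: "cycle_mean (linear_product l) n
      = of_nat (full_cycles i) / fact i * cycle_mean (linear_product l'') (n - i)
        + c * cycle_mean (linear_product l') n" if "i \<le> n" for n
  proof -
    have "linear_product l = (\<lambda>x. of_nat (x i) * linear_product l' x + c * linear_product l' x)"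
      by (simp add: l linear_product_def fun_eq_iff distrib_right)
    then show ?thesis
      using cycle_mean_times_variable[OF that, of "linear_product l'"]
      by (simp add: cycle_mean_add cycle_mean_scale linear_product_incr l''_def)
  qed
  show ?case
    unfolding stable_from_def
  proof (intro allI impI)
    fix m n assume "m \<ge> sum_list (map fst l)" "n \<ge> sum_list (map fst l)"
    then have mn: "m \<ge> i + d" "n \<ge> i + d" by (simp_all add: l d_def)
    then have "cycle_mean (linear_product l'') (m - i) = cycle_mean (linear_product l'') (n - i)"
      "cycle_mean (linear_product l') m = cycle_mean (linear_product l') n"
      using stable by (simp_all add: stable_from_def)
    then show "cycle_mean (linear_product l) m = cycle_mean (linear_product l) n"
      using mn mean[of m] mean[of n] by simp
  qed
qed

lemma monomial_is_linear_product:
  assumes "finite S"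
  obtains l :: "(nat \<times> 'k::field_char_0) list"
  where "sum_list (map fst l) = (\<Sum>i\<in>S. i * e i)"
    and "linear_product l = (\<lambda>x. \<Prod>i\<in>S. of_nat (x i) ^ e i)"
proof -
  have "\<exists>l :: (nat \<times> 'k) list. sum_list (map fst l) = (\<Sum>i\<in>S. i * e i)
      \<and> linear_product l = (\<lambda>x. \<Prod>i\<in>S. of_nat (x i) ^ e i)"
    using assms
  proof (induction S)
    case empty
    show ?case by (intro exI[of _ "[]"]) (simp add: linear_product_def fun_eq_iff)
  next
    case (insert j S)
    then obtain l :: "(nat \<times> 'k) list" where "sum_list (map fst l) = (\<Sum>i\<in>S. i * e i)"
      "linear_product l = (\<lambda>x. \<Prod>i\<in>S. of_nat (x i) ^ e i)" by blast
    then show ?case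
      using insert by (intro exI[of _ "replicate (e j) (j, 0) @ l"])
        (simp add: linear_product_def fun_eq_iff sum_list_replicate)
  qed
  then show ?thesis using that by blast
qed

lemma monom_degree_le_graded_degree:
  "m \<in> Poly_Mapping.keys q \<Longrightarrow> monom_degree m \<le> graded_degree q"
  unfolding graded_degree_def by (intro Max_ge) auto

lemma stable_from_mono: "stable_from d F \<Longrightarrow> d \<le> e \<Longrightarrow> stable_from e F"
  unfolding stable_from_def using le_trans by blast

lemma linear_product_append: "linear_product (l @ l') x = linear_product l x * linear_product l' x"
  by (simp add: linear_product_def)

text \<open>
  After expanding both factors, each product of two monomials is the \<^const>\<open>linear_product\<close> of
  the concatenated lists, and the degrees of the two monomials add up to at most the threshold.
\<close>

lemma stable_from_poly_eval_product:
  fixes p q :: "'k::field_char_0 poly_vars"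
  shows "stable_from (graded_degree p + graded_degree q)
    (\<lambda>x. poly_eval (\<lambda>i. of_nat (x i)) p * poly_eval (\<lambda>i. of_nat (x i)) q)"
proof -
  let ?P = "Poly_Mapping.keys p" and ?Q = "Poly_Mapping.keys q"
  define M :: "(nat \<Rightarrow>\<^sub>0 nat) \<Rightarrow> (nat \<Rightarrow> nat) \<Rightarrow> 'k"
    where "M m x = (\<Prod>i\<in>Poly_Mapping.keys m. of_nat (x i) ^ Poly_Mapping.lookup m i)" for m x
  have "stable_from (graded_degree p + graded_degree q)
    (\<lambda>x. \<Sum>ab\<in>?P \<times> ?Q. (Poly_Mapping.lookup p (fst ab) * Poly_Mapping.lookup q (snd ab))
      * (M (fst ab) x * M (snd ab) x))"
  proof (rule stable_from_linear_combination)
    fix ab assume "ab \<in> ?P \<times> ?Q"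
    then have deg: "monom_degree (fst ab) + monom_degree (snd ab) \<le> graded_degree p + graded_degree q"
      by (intro add_mono monom_degree_le_graded_degree) auto
    obtain l where l: "sum_list (map fst l) = monom_degree (fst ab)" "linear_product l = M (fst ab)"
      using monomial_is_linear_product[OF finite_keys[of "fst ab"], of "Poly_Mapping.lookup (fst ab)"]
      unfolding M_def[abs_def] monom_degree_def by blast
    obtain l' where l': "sum_list (map fst l') = monom_degree (snd ab)" "linear_product l' = M (snd ab)"
      using monomial_is_linear_product[OF finite_keys[of "snd ab"], of "Poly_Mapping.lookup (snd ab)"]
      unfolding M_def[abs_def] monom_degree_def by blast
    have "linear_product (l @ l') = (\<lambda>x. M (fst ab) x * M (snd ab) x)"
      by (simp add: fun_eq_iff linear_product_append l l')
    then show "stable_from (graded_degree p + graded_degree q) (\<lambda>x. M (fst ab) x * M (snd ab) x)"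
      using stable_from_mono[OF stable_from_linear_product[of "l @ l'"]] deg l l' by simp
  qed
  then show ?thesis
    by (simp add: poly_eval_def M_def sum_product sum.cartesian_product case_prod_unfold mult_ac)
qed

lemma moment_eq_cycle_mean:
  "moment q n = cycle_mean (\<lambda>x. poly_eval (\<lambda>i. of_nat (x i)) q) n"
  by (simp add: moment_def cycle_mean_def eval_cycles_def sym_group_def)

lemma moment_stable:
  assumes "n \<ge> graded_degree q"
  shows "moment q n = moment q (graded_degree q)"
proof -
  have "poly_eval x (1 :: 'a poly_vars) = 1" for x
    by (simp add: poly_eval_def)
  moreover have "graded_degree (1 :: 'a poly_vars) = 0"
    by (simp add: graded_degree_def monom_degree_def)
  ultimately have "stable_from (graded_degree q) (\<lambda>x. poly_eval (\<lambda>i. of_nat (x i)) q)"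
    using stable_from_poly_eval_product[of q 1] by (simp only: mult_1_right add_0_right)
  then show ?thesis
    using assms unfolding moment_eq_cycle_mean stable_from_def by blast
qed

section \<open>Traces of projections\<close>

context vector_space
begin

text \<open>
  The basis that \<^const>\<open>trace_on\<close> chooses depends on the space only, so one basis computes the
  traces of all group elements at once.
\<close>

lemma trace_on_basis:
  assumes "finite S" "span S = V"
  obtains B where "finite B" "independent B" "span B = V"
    "\<And>f. trace_on V f = (\<Sum>b\<in>B. representation B (f b) b)"
proof -
  define B where "B = (SOME B. independent B \<and> span B = V)"
  obtain B0 where "B0 \<subseteq> S" "independent B0" "S \<subseteq> span B0"
    using maximal_independent_subset[of S] by blast
  then have "independent B0 \<and> span B0 = V"
    using assms(2) span_mono[of B0 S] span_minimal[of S "span B0"] by auto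
  then have B: "independent B \<and> span B = V"
    unfolding B_def by (rule someI)
  moreover have "finite B"
    using independent_span_bound[of S B] assms B span_superset[of B] by auto
  ultimately show ?thesis
    using that[of B] by (auto simp: trace_on_def B_def Let_def)
qed

lemma linear_within_representation:
  assumes "independent B" "span B = V"
  shows "linear_within scale (*) V (\<lambda>v. representation B v b)"
  using assms by (auto simp: linear_within_def representation_add representation_scale)

end

lemma linear_withinD:
  assumes "linear_within s t V f"
  shows "x \<in> V \<Longrightarrow> y \<in> V \<Longrightarrow> f (x + y) = f x + f y"
    and "x \<in> V \<Longrightarrow> f (s c x) = t c (f x)"
  using assms by (auto simp: linear_within_def)

lemma linear_within_sum:
  assumes "vector_space s" "vector_space t" "module.subspace s V" "linear_within s t V f"
    and "\<And>i. i \<in> I \<Longrightarrow> v i \<in> V"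
  shows "f (\<Sum>i\<in>I. s (c i) (v i)) = (\<Sum>i\<in>I. t (c i) (f (v i)))"
proof -
  interpret s: vector_space s by fact
  interpret t: vector_space t by fact
  note V = assms(3)
  have f0: "f 0 = 0"
    using linear_withinD(2)[OF assms(4) s.subspace_0[OF V], of 0] by simp
  show ?thesis
    using assms(5)
  proof (induction I rule: infinite_finite_induct)
    case (insert i I)
    have "f (s (c i) (v i) + (\<Sum>i\<in>I. s (c i) (v i))) = f (s (c i) (v i)) + f (\<Sum>i\<in>I. s (c i) (v i))"
      using insert.prems
      by (intro linear_withinD(1)[OF assms(4)] s.subspace_scale[OF V] s.subspace_sum[OF V]) auto
    then show ?case
      using insert linear_withinD(2)[OF assms(4), of "v i" "c i"] by simp
  qed (simp_all add: f0)
qed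

lemma vector_space_over_itself: "vector_space ((*) :: 'k::field \<Rightarrow> 'k \<Rightarrow> 'k)"
  by unfold_locales (simp_all add: algebra_simps)

text \<open>
  The trace of a projection is the dimension of its image. The vectors \<open>e\<close> with the coordinate
  functionals \<open>\<phi>\<close> take the place of a basis of the ambient space \<open>H\<close>. Expanding each \<open>P (e i)\<close> in a
  basis \<open>D\<close> of the image and exchanging the sums turns the trace into the sum over \<open>d \<in> D\<close> of the
  \<open>d\<close>-th coordinate of \<open>P d = d\<close>, that is, into the number of elements of \<open>D\<close>.
\<close>

lemma (in vector_space) trace_projection:
  assumes H: "subspace H" and I: "finite I"
    and e: "\<And>i. i \<in> I \<Longrightarrow> e i \<in> H"
    and coord: "\<And>i. i \<in> I \<Longrightarrow> linear_within scale (*) H (\<phi> i)"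
    and expand: "\<And>f. f \<in> H \<Longrightarrow> f = (\<Sum>i\<in>I. \<phi> i f *s e i)"
    and P: "linear_within scale scale H P" "\<And>f. f \<in> H \<Longrightarrow> P f \<in> U" "\<And>u. u \<in> U \<Longrightarrow> P u = u"
    and U: "subspace U" "U \<subseteq> H"
  shows "(\<Sum>i\<in>I. \<phi> i (P (e i))) = of_nat (dim U)"
proof -
  obtain D where D: "D \<subseteq> U" "independent D" "U \<subseteq> span D" "card D = dim U"
    using basis_exists by blast
  then have spanD: "span D = U"
    using span_minimal[OF D(1) U(1)] by auto
  have "U \<subseteq> span (e ` I)"
  proof
    fix u assume "u \<in> U"
    then have "u = (\<Sum>i\<in>I. \<phi> i u *s e i)" using U expand by blast
    also have "\<dots> \<in> span (e ` I)" by (intro span_sum span_scale span_base) auto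
    finally show "u \<in> span (e ` I)" .
  qed
  then have finD: "finite D"
    using independent_span_bound[of "e ` I" D] D I by auto
  let ?r = "representation D"
  note lin_r = linear_within_representation[OF D(2) spanD]
  have "(\<Sum>i\<in>I. \<phi> i (P (e i))) = (\<Sum>i\<in>I. \<Sum>d\<in>D. ?r (P (e i)) d * \<phi> i d)"
  proof (rule sum.cong)
    fix i assume i: "i \<in> I"
    have "P (e i) = (\<Sum>d\<in>D. ?r (P (e i)) d *s d)"
      using sum_representation_eq[OF D(2), of "P (e i)" D] finD e[OF i] P(2) spanD by auto
    also have "\<phi> i \<dots> = (\<Sum>d\<in>D. ?r (P (e i)) d * \<phi> i d)"
      using D(1) U(2)
      by (intro linear_within_sum[OF vector_space_axioms vector_space_over_itself H coord[OF i]]) auto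
    finally show "\<phi> i (P (e i)) = (\<Sum>d\<in>D. ?r (P (e i)) d * \<phi> i d)" .
  qed simp
  also have "\<dots> = (\<Sum>d\<in>D. \<Sum>i\<in>I. \<phi> i d * ?r (P (e i)) d)"
    by (subst sum.swap) (simp add: mult.commute)
  also have "\<dots> = (\<Sum>d\<in>D. 1)"
  proof (rule sum.cong)
    fix d assume d: "d \<in> D"
    then have "d \<in> U" "d \<in> H" using D(1) U(2) by auto
    have "(\<Sum>i\<in>I. \<phi> i d * ?r (P (e i)) d) = ?r (\<Sum>i\<in>I. \<phi> i d *s P (e i)) d"
      using e P(2) by (intro linear_within_sum[OF vector_space_axioms vector_space_over_itself U(1) lin_r, symmetric]) auto
    also have "(\<Sum>i\<in>I. \<phi> i d *s P (e i)) = P (\<Sum>i\<in>I. \<phi> i d *s e i)"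
      using e by (intro linear_within_sum[OF vector_space_axioms vector_space_axioms H P(1), symmetric])
    also have "\<dots> = d"
      using expand[OF \<open>d \<in> H\<close>] P(3)[OF \<open>d \<in> U\<close>] by simp
    finally show "(\<Sum>i\<in>I. \<phi> i d * ?r (P (e i)) d) = 1"
      using representation_basis[OF D(2) d] by simp
  qed simp
  finally show ?thesis by (simp add: D(4))
qed

section \<open>The averaging projection on linear maps between representations\<close>

lemma sym_repD:
  assumes "vector_space s" "vector_space.sym_rep s n V \<rho>"
  shows "module.subspace s V" "\<exists>B. finite B \<and> module.span s B = V"
    and "w permutes {1..n} \<Longrightarrow> linear_within s s V (\<rho> w)"
    and "w permutes {1..n} \<Longrightarrow> x \<in> V \<Longrightarrow> \<rho> w x \<in> V"
    and "u permutes {1..n} \<Longrightarrow> w permutes {1..n} \<Longrightarrow> x \<in> V \<Longrightarrow> \<rho> (u \<circ> w) x = \<rho> u (\<rho> w x)"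
    and "x \<in> V \<Longrightarrow> \<rho> id x = x"
proof -
  interpret vector_space s by fact
  interpret group_action "sym_group n" V \<rho>
    using assms(2) by (simp add: sym_rep_def)
  show "subspace V" "\<exists>B. finite B \<and> span B = V"
    "w permutes {1..n} \<Longrightarrow> linear_within s s V (\<rho> w)"
    using assms(2) by (simp_all add: sym_rep_def sym_group_carrier)
  show "w permutes {1..n} \<Longrightarrow> x \<in> V \<Longrightarrow> \<rho> w x \<in> V"
    using element_image[of w x "\<rho> w x"] by (simp add: sym_group_carrier)
  show "u permutes {1..n} \<Longrightarrow> w permutes {1..n} \<Longrightarrow> x \<in> V \<Longrightarrow> \<rho> (u \<circ> w) x = \<rho> u (\<rho> w x)"
    using composition_rule[of x u w] by (simp add: sym_group_carrier sym_group_mult)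
  show "x \<in> V \<Longrightarrow> \<rho> id x = x"
    using id_eq_one by (metis restrict_apply' sym_group_one)
qed

locale sym_rep_pair = s: vector_space s + t: vector_space t
  for s :: "'k::field_char_0 \<Rightarrow> 'v::ab_group_add \<Rightarrow> 'v"
    and t :: "'k \<Rightarrow> 'w::ab_group_add \<Rightarrow> 'w" +
  fixes n :: nat and V \<rho> W \<sigma>
  assumes rep_V: "s.sym_rep n V \<rho>" and rep_W: "t.sym_rep n W \<sigma>"
begin

abbreviation scale_fun :: "'k \<Rightarrow> ('v \<Rightarrow> 'w) \<Rightarrow> 'v \<Rightarrow> 'w" where
  "scale_fun \<equiv> (\<lambda>c f x. t c (f x))"

sublocale ts: vector_space scale_fun
  by (rule vector_space_pointwise[OF t.vector_space_axioms])

abbreviation "G \<equiv> {w :: nat \<Rightarrow> nat. w permutes {1..n}}"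

lemmas V_rep = sym_repD[OF s.vector_space_axioms rep_V]
lemmas W_rep = sym_repD[OF t.vector_space_axioms rep_W]
lemmas W_closed = t.subspace_add[OF W_rep(1)] t.subspace_scale[OF W_rep(1)] t.subspace_0[OF W_rep(1)]
  t.subspace_sum[OF W_rep(1)]
lemmas V_closed = s.subspace_add[OF V_rep(1)] s.subspace_scale[OF V_rep(1)]

lemma \<sigma>_linear:
  assumes "w permutes {1..n}" "x \<in> W"
  shows "y \<in> W \<Longrightarrow> \<sigma> w (x + y) = \<sigma> w x + \<sigma> w y" "\<sigma> w (t c x) = t c (\<sigma> w x)"
  using linear_withinD[OF W_rep(3)[OF assms(1)]] assms by auto

lemma \<rho>_linear:
  assumes "w permutes {1..n}" "x \<in> V"
  shows "y \<in> V \<Longrightarrow> \<rho> w (x + y) = \<rho> w x + \<rho> w y" "\<rho> w (s c x) = s c (\<rho> w x)"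
  using linear_withinD[OF V_rep(3)[OF assms(1)]] assms by auto

lemma \<sigma>_sum:
  assumes "w permutes {1..n}" "\<And>i. i \<in> I \<Longrightarrow> v i \<in> W"
  shows "\<sigma> w (\<Sum>i\<in>I. v i) = (\<Sum>i\<in>I. \<sigma> w (v i))"
  using linear_within_sum[OF t.vector_space_axioms t.vector_space_axioms W_rep(1)
      W_rep(3)[OF assms(1)], of I v "\<lambda>_. 1"] assms(2) by simp

text \<open>
  The ambient space of the averaging projection: as in \<^const>\<open>sym_hom\<close>, linear maps are extended by
  \<open>0\<close>, so that they are determined by their values on \<open>V\<close>.
\<close>

definition lin_maps :: "('v \<Rightarrow> 'w) set" where
  "lin_maps = {f. f ` V \<subseteq> W \<and> (\<forall>x. x \<notin> V \<longrightarrow> f x = 0) \<and> linear_within s t V f}"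

definition invariant_maps :: "('v \<Rightarrow> 'w) set" where
  "invariant_maps = sym_hom n s V \<rho> t W \<sigma>"

text \<open>
  Cut off outside \<open>V\<close> so that it maps \<open>lin_maps\<close> into itself.
\<close>

definition average :: "('v \<Rightarrow> 'w) \<Rightarrow> 'v \<Rightarrow> 'w" where
  "average f x = (if x \<in> V then t (1 / fact n) (\<Sum>w\<in>G. \<sigma> w (f (\<rho> (inv' w) x))) else 0)"

lemma lin_mapsI:
  assumes "\<And>x. x \<in> V \<Longrightarrow> f x \<in> W" "\<And>x. x \<notin> V \<Longrightarrow> f x = 0"
    "\<And>x y. x \<in> V \<Longrightarrow> y \<in> V \<Longrightarrow> f (x + y) = f x + f y"
    "\<And>c x. x \<in> V \<Longrightarrow> f (s c x) = t c (f x)"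
  shows "f \<in> lin_maps"
  using assms by (auto simp: lin_maps_def linear_within_def)

lemma lin_mapsD:
  assumes "f \<in> lin_maps"
  shows "x \<in> V \<Longrightarrow> f x \<in> W" "x \<notin> V \<Longrightarrow> f x = 0"
    "x \<in> V \<Longrightarrow> y \<in> V \<Longrightarrow> f (x + y) = f x + f y" "x \<in> V \<Longrightarrow> f (s c x) = t c (f x)"
  using assms by (auto simp: lin_maps_def linear_within_def)

lemma invariant_maps_iff:
  "f \<in> invariant_maps \<longleftrightarrow> f \<in> lin_maps \<and> (\<forall>w\<in>G. \<forall>x\<in>V. f (\<rho> w x) = \<sigma> w (f x))"
  by (auto simp: invariant_maps_def lin_maps_def sym_hom_def sym_group_carrier)

lemma subspace_lin_maps: "ts.subspace lin_maps"
  unfolding ts.subspace_def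
  by (intro conjI ballI allI; rule lin_mapsI)
    (auto simp: lin_mapsD W_closed t.scale_right_distrib mult.commute add_ac)

lemma subspace_invariant_maps: "ts.subspace invariant_maps"
proof -
  have "\<sigma> w 0 = 0" if "w permutes {1..n}" for w
    using \<sigma>_sum[OF that, of "{}"] by simp
  then show ?thesis
    using subspace_lin_maps
    by (auto simp: ts.subspace_def invariant_maps_iff lin_mapsD \<sigma>_linear)
qed

lemma average_term_closed:
  assumes "f \<in> lin_maps" "w permutes {1..n}" "x \<in> V"
  shows "\<sigma> w (f (\<rho> (inv' w) x)) \<in> W"
  using assms by (simp add: W_rep(4) V_rep(4) lin_mapsD permutes_inv)

lemma average_in_lin_maps:
  assumes f: "f \<in> lin_maps"
  shows "average f \<in> lin_maps"
proof (rule lin_mapsI)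
  show "average f x \<in> W" if "x \<in> V" for x
    using that by (auto simp: average_def intro!: W_closed average_term_closed[OF f])
  show "average f x = 0" if "x \<notin> V" for x
    using that by (simp add: average_def)
  show "average f (x + y) = average f x + average f y" if xy: "x \<in> V" "y \<in> V" for x y
  proof -
    have "(\<Sum>w\<in>G. \<sigma> w (f (\<rho> (inv' w) (x + y))))
        = (\<Sum>w\<in>G. \<sigma> w (f (\<rho> (inv' w) x)) + \<sigma> w (f (\<rho> (inv' w) y)))"
      using xy by (intro sum.cong)
        (simp_all add: \<rho>_linear \<sigma>_linear lin_mapsD[OF f] V_rep(4) permutes_inv)
    then show ?thesis
      using xy by (simp add: average_def V_closed sum.distrib t.scale_right_distrib)
  qed
  show "average f (s c x) = t c (average f x)" if x: "x \<in> V" for c x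
  proof -
    have "(\<Sum>w\<in>G. \<sigma> w (f (\<rho> (inv' w) (s c x)))) = (\<Sum>w\<in>G. t c (\<sigma> w (f (\<rho> (inv' w) x))))"
      using x by (intro sum.cong)
        (simp_all add: \<rho>_linear \<sigma>_linear lin_mapsD[OF f] V_rep(4) permutes_inv)
    then show ?thesis
      using x by (simp add: average_def V_closed t.scale_sum_right[symmetric] mult.commute)
  qed
qed

text \<open>
  The usual argument: acting by \<open>u\<close> permutes the terms of the average.
\<close>

lemma average_invariant:
  assumes f: "f \<in> lin_maps"
  shows "average f \<in> invariant_maps"
  unfolding invariant_maps_iff
proof (intro conjI ballI average_in_lin_maps[OF f])
  fix u x assume "u \<in> G" and x: "x \<in> V"
  then have u: "u permutes {1..n}" by simp
  have "(\<Sum>w\<in>G. \<sigma> w (f (\<rho> (inv' w) (\<rho> u x)))) = (\<Sum>w\<in>G. \<sigma> u (\<sigma> w (f (\<rho> (inv' w) x))))"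
    \<comment> \<open>Substituting \<open>u \<circ> w\<close> for \<open>w\<close> moves \<open>u\<close> from the right of \<open>f\<close> to the left.\<close>
  proof (rule sum.reindex_bij_witness[where i = "\<lambda>w. u \<circ> w" and j = "\<lambda>w. inv' u \<circ> w"])
    fix w assume "w \<in> G"
    then have w: "w permutes {1..n}" by simp
    show *: "u \<circ> (inv' u \<circ> w) = w" and "inv' u \<circ> (u \<circ> w) = w"
      using permutes_inv_o[OF u] by (simp_all flip: o_assoc add: o_assoc)
    have iuw: "inv' u \<circ> w permutes {1..n}"
      using u w by (simp add: permutes_compose permutes_inv)
    then show "inv' u \<circ> w \<in> G" by simp
    show "u \<circ> w \<in> G" using permutes_compose[OF w u] by simp
    have "inv' (inv' u \<circ> w) = inv' w \<circ> u"
      using o_inv_distrib[OF permutes_bij[OF permutes_inv[OF u]] permutes_bij[OF w]]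
      by (simp add: inv_inv_eq permutes_bij[OF u])
    then have "\<rho> (inv' (inv' u \<circ> w)) x = \<rho> (inv' w) (\<rho> u x)"
      using V_rep(5)[OF permutes_inv[OF w] u x] by simp
    moreover have "\<sigma> u (\<sigma> (inv' u \<circ> w) y) = \<sigma> w y" if "y \<in> W" for y
      using W_rep(5)[OF u iuw that] * by simp
    ultimately show "\<sigma> u (\<sigma> (inv' u \<circ> w) (f (\<rho> (inv' (inv' u \<circ> w)) x)))
        = \<sigma> w (f (\<rho> (inv' w) (\<rho> u x)))"
      using u w x by (simp add: lin_mapsD[OF f] V_rep(4) permutes_inv)
  qed
  also have "\<dots> = \<sigma> u (\<Sum>w\<in>G. \<sigma> w (f (\<rho> (inv' w) x)))"
    using x by (intro \<sigma>_sum[OF u, symmetric]) (simp add: average_term_closed[OF f])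
  finally have equivariant: "(\<Sum>w\<in>G. \<sigma> w (f (\<rho> (inv' w) (\<rho> u x))))
      = \<sigma> u (\<Sum>w\<in>G. \<sigma> w (f (\<rho> (inv' w) x)))" .
  have "(\<Sum>w\<in>G. \<sigma> w (f (\<rho> (inv' w) x))) \<in> W"
    using x by (intro W_closed(4)) (simp add: average_term_closed[OF f])
  from \<sigma>_linear(2)[OF u this] equivariant show "average f (\<rho> u x) = \<sigma> u (average f x)"
    using x V_rep(4)[OF u x] by (simp add: average_def)
qed

lemma average_fixes_invariant:
  assumes f: "f \<in> invariant_maps"
  shows "average f = f"
proof
  fix x
  have lin: "f \<in> lin_maps" using f by (simp add: invariant_maps_iff)
  show "average f x = f x"
  proof (cases "x \<in> V")
    case True
    have "(\<Sum>w\<in>G. \<sigma> w (f (\<rho> (inv' w) x))) = (\<Sum>w\<in>G. t 1 (f x))"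
    proof (rule sum.cong)
      fix w assume "w \<in> G"
      then have w: "w permutes {1..n}" by simp
      have "\<sigma> w (f (\<rho> (inv' w) x)) = f (\<rho> w (\<rho> (inv' w) x))"
        using f w True by (simp add: invariant_maps_iff V_rep(4) permutes_inv)
      also have "\<rho> w (\<rho> (inv' w) x) = x"
        using V_rep(5)[OF w permutes_inv[OF w] True] V_rep(6)[OF True] permutes_inv_o[OF w] by simp
      finally show "\<sigma> w (f (\<rho> (inv' w) x)) = t 1 (f x)" by simp
    qed simp
    also have "\<dots> = t (fact n) (f x)"
      unfolding t.scale_sum_left[symmetric] by (simp add: card_permutations)
    finally show ?thesis using True by (simp add: average_def)
  qed (simp add: average_def lin_mapsD[OF lin])
qed

lemma average_linear: "linear_within scale_fun scale_fun lin_maps average"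
  unfolding linear_within_def
proof (intro conjI ballI allI ext)
  fix f g x assume f: "f \<in> lin_maps" and g: "g \<in> lin_maps"
  show "average (f + g) x = (average f + average g) x"
    by (simp add: average_def lin_mapsD[OF f] lin_mapsD[OF g] \<sigma>_linear V_rep(4) permutes_inv
        sum.distrib t.scale_right_distrib)
next
  fix c f x assume f: "f \<in> lin_maps"
  have "(\<Sum>w\<in>G. \<sigma> w (t c (f (\<rho> (inv' w) x)))) = t c (\<Sum>w\<in>G. \<sigma> w (f (\<rho> (inv' w) x)))"
    if "x \<in> V"
    unfolding t.scale_sum_right using that
    by (intro sum.cong) (simp_all add: lin_mapsD[OF f] \<sigma>_linear V_rep(4) permutes_inv)
  then show "average (\<lambda>x. t c (f x)) x = t c (average f x)"
    by (simp add: average_def mult.commute)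
qed

text \<open>
  The matrix units for bases \<open>B\<close> and \<open>C\<close>, with the matrix entries as coordinates, have the expansion
  property that \<open>trace_projection\<close> asks for.
\<close>

lemma lin_maps_matrix_expansion:
  assumes B: "finite B" "s.independent B" "s.span B = V"
    and C: "finite C" "t.independent C" "t.span C = W"
    and f: "f \<in> lin_maps"
  shows "f = (\<Sum>(b, c)\<in>B \<times> C. scale_fun (t.representation C (f b) c)
    (\<lambda>x. if x \<in> V then t (s.representation B x b) c else 0))"
    (is "f = (\<Sum>(b, c)\<in>B \<times> C. ?g b c)")
proof
  fix x
  have BV: "B \<subseteq> V" using B s.span_superset by blast
  have sum_fun: "(\<Sum>i\<in>I. g i) x = (\<Sum>i\<in>I. g i x)"
    for I :: "('v \<times> 'w) set" and g :: "_ \<Rightarrow> 'v \<Rightarrow> 'w"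
    by (induction I rule: infinite_finite_induct) auto
  show "f x = (\<Sum>(b, c)\<in>B \<times> C. ?g b c) x"
  proof (cases "x \<in> V")
    case True
    let ?r = "s.representation B x"
    have lin: "linear_within s t V f" using f by (simp add: lin_maps_def)
    have "f x = f (\<Sum>b\<in>B. s (?r b) b)"
      using s.sum_representation_eq[OF B(2), of x B] B True by simp
    also have "\<dots> = (\<Sum>b\<in>B. t (?r b) (f b))"
      using BV by (intro linear_within_sum[OF s.vector_space_axioms t.vector_space_axioms V_rep(1) lin]) auto
    also have "\<dots> = (\<Sum>b\<in>B. t (?r b) (\<Sum>c\<in>C. t (t.representation C (f b) c) c))"
    proof (intro sum.cong refl arg_cong[of _ _ "t _"])
      fix b assume "b \<in> B"
      then have "f b \<in> W" using BV lin_mapsD[OF f] by auto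
      then show "f b = (\<Sum>c\<in>C. t (t.representation C (f b) c) c)"
        using t.sum_representation_eq[OF C(2), of "f b" C] C by simp
    qed
    also have "\<dots> = (\<Sum>b\<in>B. \<Sum>c\<in>C. ?g b c x)"
      using True by (simp add: t.scale_sum_right mult.commute)
    finally show ?thesis by (simp add: sum_fun sum.cartesian_product case_prod_unfold)
  next
    case False
    then show ?thesis by (simp add: sum_fun lin_mapsD[OF f] case_prod_unfold)
  qed
qed

text \<open>
  The coordinate at a matrix unit \<open>(b, c)\<close> of the map \<open>\<sigma> w \<circ> e \<circ> \<rho> w\<inverse>\<close>, for \<open>e\<close> that same matrix unit,
  is the \<open>b\<close>-th diagonal entry of \<open>\<rho> w\<inverse>\<close> times the \<open>c\<close>-th diagonal entry of \<open>\<sigma> w\<close>. The trace of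
  averaging is therefore a sum of products of two traces.
\<close>

lemma hom_dim_eq_character_pairing:
  "of_nat (hom_dim n s V \<rho> t W \<sigma>)
    = (\<Sum>w\<in>G. s.trace_on V (\<rho> (inv' w)) * t.trace_on W (\<sigma> w)) / fact n"
proof -
  obtain B where B: "finite B" "s.independent B" "s.span B = V"
    "\<And>f. s.trace_on V f = (\<Sum>b\<in>B. s.representation B (f b) b)"
    using V_rep(2) s.trace_on_basis by metis
  obtain C where C: "finite C" "t.independent C" "t.span C = W"
    "\<And>f. t.trace_on W f = (\<Sum>c\<in>C. t.representation C (f c) c)"
    using W_rep(2) t.trace_on_basis by metis
  let ?rB = "s.representation B" and ?rC = "t.representation C"
  have BV: "B \<subseteq> V" and CW: "C \<subseteq> W"
    using B C s.span_superset t.span_superset by blast+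
  note rB = s.linear_within_representation[OF B(2,3)]
    and rC = t.linear_within_representation[OF C(2,3)]
  define e where "e = (\<lambda>i x. if x \<in> V then t (?rB x (fst i)) (snd i) else 0)"
  define \<phi> where "\<phi> = (\<lambda>i (f :: 'v \<Rightarrow> 'w). ?rC (f (fst i)) (snd i))"
  have eH: "e i \<in> lin_maps" if i: "i \<in> B \<times> C" for i
  proof -
    have "snd i \<in> W" using CW i by auto
    then show ?thesis
      by (intro lin_mapsI)
        (auto simp: e_def V_closed W_closed linear_withinD[OF rB] t.scale_left_distrib)
  qed
  have \<phi>_lin: "linear_within scale_fun (*) lin_maps (\<phi> i)" if i: "i \<in> B \<times> C" for i
  proof -
    have "fst i \<in> V" using BV i by auto
    then show ?thesis
      unfolding linear_within_def by (auto simp: \<phi>_def lin_mapsD linear_withinD[OF rC])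
  qed
  have expand: "f = (\<Sum>i\<in>B \<times> C. scale_fun (\<phi> i f) (e i))" if "f \<in> lin_maps" for f
    using lin_maps_matrix_expansion[OF B(1-3) C(1-3) that]
    by (simp add: e_def \<phi>_def case_prod_unfold)
  have sub: "invariant_maps \<subseteq> lin_maps" by (auto simp: invariant_maps_iff)
  have "of_nat (ts.dim invariant_maps) = (\<Sum>i\<in>B \<times> C. \<phi> i (average (e i)))"
    using B(1) C(1)
    by (intro ts.trace_projection[OF subspace_lin_maps _ eH \<phi>_lin expand average_linear
          average_invariant average_fixes_invariant subspace_invariant_maps sub, symmetric]) auto
  also have "\<dots> = (\<Sum>i\<in>B \<times> C. \<Sum>w\<in>G.
      (?rB (\<rho> (inv' w) (fst i)) (fst i) * ?rC (\<sigma> w (snd i)) (snd i)) / fact n)"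
  proof (rule sum.cong)
    fix i assume "i \<in> B \<times> C"
    then obtain b c where bc: "i = (b, c)" "b \<in> B" "c \<in> C" by auto
    then have b: "b \<in> V" and c: "c \<in> W" using BV CW by auto
    have "average (e i) b = (\<Sum>w\<in>G. t (1 / fact n * ?rB (\<rho> (inv' w) b) b) (\<sigma> w c))"
      using b c
      by (simp add: average_def e_def bc V_rep(4) permutes_inv \<sigma>_linear t.scale_sum_right)
    then have "\<phi> i (average (e i)) = ?rC (\<Sum>w\<in>G. t (1 / fact n * ?rB (\<rho> (inv' w) b) b) (\<sigma> w c)) c"
      by (simp add: \<phi>_def bc)
    also have "\<dots> = (\<Sum>w\<in>G. (1 / fact n * ?rB (\<rho> (inv' w) b) b) * ?rC (\<sigma> w c) c)"
      using c W_rep(4)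
      by (intro linear_within_sum[OF t.vector_space_axioms vector_space_over_itself W_rep(1) rC]) auto
    finally show "\<phi> i (average (e i)) = (\<Sum>w\<in>G.
      (?rB (\<rho> (inv' w) (fst i)) (fst i) * ?rC (\<sigma> w (snd i)) (snd i)) / fact n)"
      by (simp add: bc)
  qed simp
  also have "\<dots> = (\<Sum>w\<in>G. s.trace_on V (\<rho> (inv' w)) * t.trace_on W (\<sigma> w)) / fact n"
    by (subst sum.swap)
      (simp add: B(4) C(4) sum_product sum.cartesian_product case_prod_unfold sum_divide_distrib)
  finally show ?thesis
    by (simp add: hom_dim_def invariant_maps_def)
qed

end

section \<open>Stability\<close>

lemma eval_cycles_inverse:
  assumes "w permutes {1..n}"
  shows "eval_cycles n q (inv' w) = eval_cycles n q w"
proof -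
  have "permutation w" using assms permutation_permutes by blast
  then show ?thesis
    by (simp add: eval_cycles_def cycle_count_def cyclic_on_def orbit_inv_eq)
qed

lemma hom_dim_eq_cycle_mean:
  fixes s :: "'k::field_char_0 \<Rightarrow> 'v::ab_group_add \<Rightarrow> 'v"
    and t :: "'k \<Rightarrow> 'w::ab_group_add \<Rightarrow> 'w"
  assumes "vector_space s" "vector_space t"
    and "vector_space.sym_rep s n (V n) (\<rho> n)" "vector_space.sym_rep t n (W n) (\<sigma> n)"
    and p: "has_character_polynomial s V \<rho> p" and q: "has_character_polynomial t W \<sigma> q"
    and n: "n \<ge> 1"
  shows "of_nat (hom_dim n s (V n) (\<rho> n) t (W n) (\<sigma> n))
    = cycle_mean (\<lambda>x. poly_eval (\<lambda>i. of_nat (x i)) p * poly_eval (\<lambda>i. of_nat (x i)) q) n"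
proof -
  interpret sym_rep_pair s t n "V n" "\<rho> n" "W n" "\<sigma> n"
    using assms by (simp add: sym_rep_pair_def sym_rep_pair_axioms_def)
  have trace_V: "s.trace_on (V n) (\<rho> n w) = eval_cycles n p w"
    and trace_W: "t.trace_on (W n) (\<sigma> n w) = eval_cycles n q w" if "w permutes {1..n}" for w
    using p q n that by (simp_all add: has_character_polynomial_def sym_group_carrier)
  have "s.trace_on (V n) (\<rho> n (inv' w)) * t.trace_on (W n) (\<sigma> n w)
      = eval_cycles n p w * eval_cycles n q w" if "w permutes {1..n}" for w
    unfolding trace_V[OF permutes_inv[OF that]] trace_W[OF that] eval_cycles_inverse[OF that] ..
  then have "(\<Sum>w\<in>G. s.trace_on (V n) (\<rho> n (inv' w)) * t.trace_on (W n) (\<sigma> n w))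
      = (\<Sum>w\<in>G. eval_cycles n p w * eval_cycles n q w)"
    by (intro sum.cong) simp_all
  then show ?thesis
    unfolding hom_dim_eq_character_pairing cycle_mean_def eval_cycles_def by simp
qed

lemma hom_dim_stable:
  fixes s :: "'k::field_char_0 \<Rightarrow> 'v::ab_group_add \<Rightarrow> 'v"
    and t :: "'k \<Rightarrow> 'w::ab_group_add \<Rightarrow> 'w"
  assumes "vector_space s" "vector_space t"
    and V: "\<And>n. n \<ge> 1 \<Longrightarrow> vector_space.sym_rep s n (V n) (\<rho> n)"
    and W: "\<And>n. n \<ge> 1 \<Longrightarrow> vector_space.sym_rep t n (W n) (\<sigma> n)"
    and p: "has_character_polynomial s V \<rho> p" and q: "has_character_polynomial t W \<sigma> q"
    and m: "m \<ge> 1" "m \<ge> graded_degree p + graded_degree q"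
    and n: "n \<ge> 1" "n \<ge> graded_degree p + graded_degree q"
  shows "hom_dim m s (V m) (\<rho> m) t (W m) (\<sigma> m) = hom_dim n s (V n) (\<rho> n) t (W n) (\<sigma> n)"
proof -
  have "of_nat (hom_dim m s (V m) (\<rho> m) t (W m) (\<sigma> m))
      = (of_nat (hom_dim n s (V n) (\<rho> n) t (W n) (\<sigma> n)) :: 'k)"
    unfolding hom_dim_eq_cycle_mean[OF assms(1,2) V[OF m(1)] W[OF m(1)] p q m(1)]
      hom_dim_eq_cycle_mean[OF assms(1,2) V[OF n(1)] W[OF n(1)] p q n(1)]
    using stable_from_poly_eval_product[of p q] m(2) n(2) unfolding stable_from_def by blast
  then show ?thesis by simp
qed

theorem corollary2p4:
  shows
    "(\<forall>q \<in> (poly_ring :: 'k::field_char_0 poly_vars set). \<forall>d. graded_degree q = d \<longrightarrow>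
        (\<forall>n\<ge>d. moment q n = moment q d)) \<and>
     (\<forall>(s :: 'k \<Rightarrow> 'v::ab_group_add \<Rightarrow> 'v) (t :: 'k \<Rightarrow> 'w::ab_group_add \<Rightarrow> 'w)
        V \<rho> W \<sigma> q\<^sub>1 q\<^sub>2 d\<^sub>1 d\<^sub>2.
        vector_space s \<longrightarrow> vector_space t \<longrightarrow>
        (\<forall>n\<ge>1. vector_space.sym_rep s n (V n) (\<rho> n)) \<longrightarrow>
        (\<forall>n\<ge>1. vector_space.sym_rep t n (W n) (\<sigma> n)) \<longrightarrow>
        has_character_polynomial s V \<rho> q\<^sub>1 \<longrightarrow> graded_degree q\<^sub>1 = d\<^sub>1 \<longrightarrow>
        has_character_polynomial t W \<sigma> q\<^sub>2 \<longrightarrow> graded_degree q\<^sub>2 = d\<^sub>2 \<longrightarrow>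
        (\<forall>m n. m \<ge> 1 \<longrightarrow> n \<ge> 1 \<longrightarrow> m \<ge> d\<^sub>1 + d\<^sub>2 \<longrightarrow> n \<ge> d\<^sub>1 + d\<^sub>2 \<longrightarrow>
           hom_dim m s (V m) (\<rho> m) t (W m) (\<sigma> m) = hom_dim n s (V n) (\<rho> n) t (W n) (\<sigma> n)))"
proof (intro conjI ballI allI impI)
  fix q :: "'k poly_vars" and d n
  assume "graded_degree q = d" "d \<le> n"
  then show "moment q n = moment q d" using moment_stable by blast
next
  fix s :: "'k \<Rightarrow> 'v \<Rightarrow> 'v" and t :: "'k \<Rightarrow> 'w \<Rightarrow> 'w" and V \<rho> W \<sigma> q\<^sub>1 q\<^sub>2 d\<^sub>1 d\<^sub>2 m n
  assume spaces: "vector_space s" "vector_space t"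
    and reps: "\<forall>n\<ge>1. vector_space.sym_rep s n (V n) (\<rho> n)"
      "\<forall>n\<ge>1. vector_space.sym_rep t n (W n) (\<sigma> n)"
    and chars: "has_character_polynomial s V \<rho> q\<^sub>1" "has_character_polynomial t W \<sigma> q\<^sub>2"
    and "graded_degree q\<^sub>1 = d\<^sub>1" "graded_degree q\<^sub>2 = d\<^sub>2"
      "1 \<le> m" "1 \<le> n" "d\<^sub>1 + d\<^sub>2 \<le> m" "d\<^sub>1 + d\<^sub>2 \<le> n"
  then show "hom_dim m s (V m) (\<rho> m) t (W m) (\<sigma> m) = hom_dim n s (V n) (\<rho> n) t (W n) (\<sigma> n)"
    by (intro hom_dim_stable[OF spaces _ _ chars]) auto
qed

end
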